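(* If $n$ is a positive integer, then $\chi_2^f(\mathbb{Z}^{\square,n})=n+1$.
   Context: $\mathbb{Z}$ denotes the two-way infinite path (vertices are the integers, with $i$ and $j$ adjacent iff $|i-j|=1$), and $\mathbb{Z}^{\square,n}$ is the Cartesian product $\mathbb{Z}\,\square\cdots\square\,\mathbb{Z}$ with $n$ factors: the infinite graph on $\mathbb{Z}^n$ in which two vertices are adjacent iff they differ in exactly one coordinate, and by exactly $1$ there. A $2$-frugal coloring of a graph is a proper vertex coloring in which no color appears more than twice in the (open) neighborhood of any vertex; $\chi_2^f$ is the minimum number of colors in a $2$-frugal coloring. *)

theory Defs
  imports "Graph_Theory.Pair_Digraph" "HOL-Library.FuncSet" "HOL-Library.Extended_Nat"
begin

text \<open>An undirected graph is represented by the loopless symmetric digraph whose arcs are the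
  ordered pairs of adjacent vertices, as in \<^locale>\<open>pair_bidirected_digraph\<close>; the vertex set may
  be infinite.\<close>

definition nbhd :: "'a pair_pre_digraph \<Rightarrow> 'a \<Rightarrow> 'a set" where
  "nbhd G v = {w \<in> pverts G. (v, w) \<in> parcs G}"

definition proper_coloring :: "'a pair_pre_digraph \<Rightarrow> ('a \<Rightarrow> 'c) \<Rightarrow> bool" where
  "proper_coloring G c \<longleftrightarrow> (\<forall>(u, v) \<in> parcs G. c u \<noteq> c v)"

text \<open>Finiteness has to be demanded separately, because an infinite set has cardinality 0
  under \<^const>\<open>card\<close>.\<close>

definition frugal_coloring :: "nat \<Rightarrow> 'a pair_pre_digraph \<Rightarrow> ('a \<Rightarrow> 'c) \<Rightarrow> bool" where
  "frugal_coloring t G c \<longleftrightarrow>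
     proper_coloring G c \<and>
     (\<forall>v \<in> pverts G. \<forall>a. finite {w \<in> nbhd G v. c w = a} \<and> card {w \<in> nbhd G v. c w = a} \<le> t)"

text \<open>The value is \<open>\<infinity>\<close> if no frugal coloring with finitely many colors exists.\<close>

definition frugal_chromatic_number :: "nat \<Rightarrow> 'a pair_pre_digraph \<Rightarrow> enat" where
  "frugal_chromatic_number t G =
     (INF k \<in> {k. \<exists>c \<in> pverts G \<rightarrow> {..<k}. frugal_coloring t G c}. enat k)"

definition int_path :: "int pair_pre_digraph" where
  "int_path = \<lparr>pverts = UNIV, parcs = {(i, j). \<bar>i - j\<bar> = 1}\<rparr>"

text \<open>Cartesian product of a family of graphs; vertices are the functions on the index set,
  normalised to \<^const>\<open>undefined\<close> outside it.\<close>

definition cartesian_product :: "'i set \<Rightarrow> ('i \<Rightarrow> 'a pair_pre_digraph) \<Rightarrow> ('i \<Rightarrow> 'a) pair_pre_digraph"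
  where
  "cartesian_product I G =
     \<lparr>pverts = (\<Pi>\<^sub>E i\<in>I. pverts (G i)),
      parcs = {(x, y). x \<in> (\<Pi>\<^sub>E i\<in>I. pverts (G i)) \<and> y \<in> (\<Pi>\<^sub>E i\<in>I. pverts (G i)) \<and>
                 (\<exists>i\<in>I. (x i, y i) \<in> parcs (G i) \<and> (\<forall>j \<in> I - {i}. x j = y j))}\<rparr>"

definition int_grid :: "nat \<Rightarrow> (nat \<Rightarrow> int) pair_pre_digraph" where
  "int_grid n = cartesian_product {..<n} (\<lambda>_. int_path)"

lemma pverts_int_grid: "pverts (int_grid n) = {..<n} \<rightarrow>\<^sub>E UNIV"
  by (simp add: int_grid_def cartesian_product_def int_path_def)

lemma parcs_int_grid:
  "(x, y) \<in> parcs (int_grid n) \<longleftrightarrow>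
     x \<in> {..<n} \<rightarrow>\<^sub>E UNIV \<and> y \<in> {..<n} \<rightarrow>\<^sub>E UNIV \<and>
     (\<exists>i<n. \<bar>x i - y i\<bar> = 1 \<and> (\<forall>j<n. j \<noteq> i \<longrightarrow> x j = y j))"
  by (auto simp: int_grid_def cartesian_product_def int_path_def)

lemma pair_bidirected_digraph_int_grid: "pair_bidirected_digraph (int_grid n)"
proof
  fix e assume e: "e \<in> parcs (int_grid n)"
  obtain x y where xy: "e = (x, y)" by (cases e)
  show "fst e \<in> pverts (int_grid n)" "snd e \<in> pverts (int_grid n)"
    using e by (auto simp: xy parcs_int_grid pverts_int_grid)
  show "fst e \<noteq> snd e"
    using e by (auto simp: xy parcs_int_grid)
next
  show "symmetric (with_proj (int_grid n))"
    unfolding symmetric_def with_proj_simps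
    by (rule symI) (auto simp: parcs_int_grid abs_minus_commute)
qed

end

theory Submission
  imports Defs "HOL-Number_Theory.Cong"
begin

text \<open>Every vertex of the grid has exactly \<open>2 * n\<close> neighbors. For the lower bound, the colors in a
  neighborhood avoid the color of its center and are each used at most twice, so at least \<open>n\<close> colors
  occur there, and the center contributes one more.

  For the upper bound, color linearly with values in the cyclic group \<open>\<int> / (n + 1)\<close>, giving the
  \<open>n\<close> unit vectors the \<open>n\<close> distinct nonzero residues \<open>1, \<dots>, n\<close>. A unit step changes the color by a
  nonzero residue, so the coloring is proper. Among the \<open>n\<close> forward steps from a vertex all color
  changes are distinct, and so they are among the \<open>n\<close> backward steps; hence a color is met at most
  once in either direction. Both bounds work with the parametrization of the neighbors by a
  coordinate and a direction, \<open>bij_betw_nbhd_int_grid\<close>.\<close>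

text \<open>The neighborhood is the union of at most \<open>k - 1\<close> color classes of size at most \<open>t\<close>.\<close>

lemma degree_le_of_frugal_coloring:
  assumes "frugal_coloring t G c" and "c \<in> pverts G \<rightarrow> {..<k}" and "v \<in> pverts G"
  shows "card (nbhd G v) \<le> t * (k - 1)"
proof -
  let ?A = "{..<k} - {c v}"
  let ?C = "\<lambda>a. {w \<in> nbhd G v. c w = a}"
  have "nbhd G v = (\<Union>a\<in>?A. ?C a)"
    using assms by (fastforce simp: nbhd_def frugal_coloring_def proper_coloring_def)
  then have "card (nbhd G v) \<le> (\<Sum>a\<in>?A. card (?C a))"
    using card_UN_le[of ?A ?C] by simp
  also have "\<dots> \<le> of_nat (card ?A) * t"
    by (rule sum_bounded_above) (use assms in \<open>auto simp: frugal_coloring_def\<close>)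
  also have "card ?A = k - 1"
    using assms(2,3) by (subst card_Diff_singleton) auto
  finally show ?thesis
    by (simp add: mult.commute)
qed

lemma bij_betw_nbhd_int_grid:
  assumes "x \<in> pverts (int_grid n)"
  shows "bij_betw (\<lambda>(i, d). x(i := x i + d)) ({..<n} \<times> {1, -1}) (nbhd (int_grid n) x)"
proof (rule bij_betw_imageI)
  show "inj_on (\<lambda>(i, d). x(i := x i + d)) ({..<n} \<times> {1, -1})"
  proof (rule inj_onI, clarify)
    fix i j :: nat and d e :: int
    assume d: "d \<in> {1, -1}" and e: "e \<in> {1, -1}"
      and eq: "x(i := x i + d) = x(j := x j + e)"
    show "i = j \<and> d = e"
      using d e fun_cong[OF eq, of i] by (auto split: if_splits)
  qed
next
  have "w \<in> (\<lambda>(i, d). x(i := x i + d)) ` ({..<n} \<times> {1, -1})"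
    if w: "w \<in> nbhd (int_grid n) x" for w
  proof -
    obtain i where i: "i < n" "\<bar>x i - w i\<bar> = 1" "\<And>j. j < n \<Longrightarrow> j \<noteq> i \<Longrightarrow> x j = w j"
      and PiE: "x \<in> {..<n} \<rightarrow>\<^sub>E UNIV" "w \<in> {..<n} \<rightarrow>\<^sub>E UNIV"
      using w by (auto simp: nbhd_def parcs_int_grid)
    have "w j = (x(i := x i + (w i - x i))) j" for j
      using i(3)[of j] PiE_arb[OF PiE(1), of j] PiE_arb[OF PiE(2), of j] by (cases "j < n") auto
    then have "w = x(i := x i + (w i - x i))" by blast
    moreover have "w i - x i \<in> {1, -1}" using i(2) by auto
    ultimately show ?thesis
      using i(1) by (intro image_eqI[of _ _ "(i, w i - x i)"]) auto
  qed
  then show "(\<lambda>(i, d). x(i := x i + d)) ` ({..<n} \<times> {1, -1}) = nbhd (int_grid n) x"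
    using assms by (fastforce simp: nbhd_def pverts_int_grid parcs_int_grid PiE_iff extensional_def)
qed

lemma card_nbhd_int_grid:
  assumes "x \<in> pverts (int_grid n)"
  shows "card (nbhd (int_grid n) x) = 2 * n"
  using bij_betw_same_card[OF bij_betw_nbhd_int_grid[OF assms]]
  by (simp add: card_cartesian_product)

definition linear_coloring :: "nat \<Rightarrow> (nat \<Rightarrow> int) \<Rightarrow> nat" where
  "linear_coloring n x = nat ((\<Sum>i<n. int (i + 1) * x i) mod int (n + 1))"

lemma linear_coloring_less: "linear_coloring n x < n + 1"
  by (simp add: linear_coloring_def nat_less_iff)

lemma linear_coloring_eq_iff:
  "linear_coloring n x = linear_coloring n y \<longleftrightarrow>
     [(\<Sum>i<n. int (i + 1) * x i) = (\<Sum>i<n. int (i + 1) * y i)] (mod int (n + 1))"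
  unfolding linear_coloring_def cong_def by (subst eq_nat_nat_iff) auto

lemma weighted_sum_update:
  fixes x :: "nat \<Rightarrow> int"
  assumes "i < n"
  shows "(\<Sum>j<n. int (j + 1) * (x(i := x i + d)) j) = (\<Sum>j<n. int (j + 1) * x j) + int (i + 1) * d"
proof -
  have "(\<Sum>j<n. int (j + 1) * (x(i := x i + d)) j)
      = (\<Sum>j<n. int (j + 1) * x j + (if j = i then int (i + 1) * d else 0))"
    by (rule sum.cong) (auto simp: algebra_simps)
  then show ?thesis
    using assms by (simp add: sum.distrib)
qed

lemma linear_coloring_step_neq:
  assumes "i < n" and "d \<in> {1, -1}"
  shows "linear_coloring n x \<noteq> linear_coloring n (x(i := x i + d))"
proof
  assume "linear_coloring n x = linear_coloring n (x(i := x i + d))"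
  then have "[int (i + 1) * d = 0] (mod int (n + 1))"
    unfolding linear_coloring_eq_iff weighted_sum_update[OF assms(1)]
    by (subst (asm) cong_sym_eq) (simp only: cong_add_lcancel_0)
  then have "int (n + 1) dvd int (i + 1)"
    using assms(2) unfolding cong_0_iff by (metis dvd_minus_iff insert_iff mult.right_neutral
        mult_minus_right singletonD)
  then show False
    using assms(1) zdvd_imp_le[of "int (n + 1)" "int (i + 1)"] by simp
qed

lemma linear_coloring_step_inj:
  assumes "i < n" and "j < n" and "d \<in> {1, -1}"
    and "linear_coloring n (x(i := x i + d)) = linear_coloring n (x(j := x j + d))"
  shows "i = j"
proof -
  have "[int (i + 1) * d = int (j + 1) * d] (mod int (n + 1))"
    using assms(4)
    unfolding linear_coloring_eq_iff weighted_sum_update[OF assms(1)]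
      weighted_sum_update[OF assms(2)]
    by (simp only: cong_add_lcancel)
  then have "[int (i + 1) = int (j + 1)] (mod int (n + 1))"
    using assms(3) by (subst (asm) cong_mult_rcancel) auto
  then show ?thesis
    using assms(1,2) by (simp add: cong_def)
qed

lemma frugal_linear_coloring: "frugal_coloring 2 (int_grid n) (linear_coloring n)"
  unfolding frugal_coloring_def
proof (intro conjI ballI allI)
  show "proper_coloring (int_grid n) (linear_coloring n)"
    unfolding proper_coloring_def
  proof clarify
    fix x y assume xy: "(x, y) \<in> parcs (int_grid n)"
      and eq: "linear_coloring n x = linear_coloring n y"
    have x: "x \<in> pverts (int_grid n)" and "y \<in> pverts (int_grid n)"
      using xy unfolding parcs_int_grid pverts_int_grid by blast+
    then have "y \<in> nbhd (int_grid n) x"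
      using xy by (simp add: nbhd_def)
    then have "y \<in> (\<lambda>(i, d). x(i := x i + d)) ` ({..<n} \<times> {1, -1})"
      by (simp only: bij_betw_imp_surj_on[OF bij_betw_nbhd_int_grid[OF x]])
    then obtain i d where "i < n" "d \<in> {1, -1}" "y = x(i := x i + d)"
      by (elim imageE SigmaE) simp
    then show False
      using eq linear_coloring_step_neq by blast
  qed
next
  fix x a assume x: "x \<in> pverts (int_grid n)"
  let ?step = "\<lambda>(i, d). x(i := x i + d)"
  let ?S = "{p \<in> {..<n} \<times> {1, -1}. linear_coloring n (?step p) = a}"
  have class_eq: "{w \<in> nbhd (int_grid n) x. linear_coloring n w = a} = ?step ` ?S"
    unfolding bij_betw_imp_surj_on[OF bij_betw_nbhd_int_grid[OF x], symmetric] by blast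
  have "finite ?S"
    by (rule finite_subset[of _ "{..<n} \<times> {1, -1}"]) auto
  then show "finite {w \<in> nbhd (int_grid n) x. linear_coloring n w = a}"
    unfolding class_eq by (rule finite_imageI)
  \<comment> \<open>The coordinate of a step is determined by its direction and the color it leads to.\<close>
  have "inj_on snd ?S"
  proof (rule inj_onI)
    fix p q assume "p \<in> ?S" "q \<in> ?S" "snd p = snd q"
    then show "p = q"
      using linear_coloring_step_inj[of "fst p" n "fst q" "snd p" x]
      by (auto simp: split_beta prod_eq_iff)
  qed
  then have "card ?S \<le> card {1, -1 :: int}"
    by (rule card_inj_on_le) auto
  then show "card {w \<in> nbhd (int_grid n) x. linear_coloring n w = a} \<le> 2"
    unfolding class_eq using card_image_le[OF \<open>finite ?S\<close>, of ?step] by simp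
qed

theorem theorem6p7:
  fixes n :: nat
  assumes "n > 0"
  shows "frugal_chromatic_number 2 (int_grid n) = enat (n + 1)"
  unfolding frugal_chromatic_number_def
proof (rule antisym)
  show "(INF k \<in> {k. \<exists>c \<in> pverts (int_grid n) \<rightarrow> {..<k}. frugal_coloring 2 (int_grid n) c}. enat k)
      \<le> enat (n + 1)"
    by (rule INF_lower) (use frugal_linear_coloring linear_coloring_less in blast)
next
  show "enat (n + 1) \<le>
      (INF k \<in> {k. \<exists>c \<in> pverts (int_grid n) \<rightarrow> {..<k}. frugal_coloring 2 (int_grid n) c}. enat k)"
  proof (rule INF_greatest)
    fix k :: nat assume "k \<in> {k. \<exists>c \<in> pverts (int_grid n) \<rightarrow> {..<k}. frugal_coloring 2 (int_grid n) c}"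
    then obtain c where c: "c \<in> pverts (int_grid n) \<rightarrow> {..<k}"
        "frugal_coloring 2 (int_grid n) c"
      by blast
    have "restrict (\<lambda>_. 0) {..<n} \<in> pverts (int_grid n)"
      by (simp add: pverts_int_grid)
    then have "2 * n \<le> 2 * (k - 1)"
      using degree_le_of_frugal_coloring[OF c(2,1)] card_nbhd_int_grid by metis
    then show "enat (n + 1) \<le> enat k"
      using assms by simp
  qed
qed

end
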